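(* Consider the evolution $\rho(t)=\rho(g_t)$ of $\rho$ under the dry-friction control $u(t)=-\mathrm{sign}\,g(0,t)$, where $g_t=g(\cdot,t)$, and let $M=\min\{\rho(0),\rho(T)\}$. Suppose that $M\to+\infty$ and $T\to+\infty$. Then $$\frac{\rho(0)-\rho(T)}{T}=1+O\left(\frac1T+\frac1M\right).$$ Under any other admissible control, $$\frac{\rho(0)-\rho(T)}{T}\le1+O\left(\frac1T+\frac1M\right).$$
   Context: $\mathcal T=\mathbb R/2\pi\mathbb Z$ and $\delta$ is the Dirac delta at $0\in\mathcal T$. The string $\frac{\partial^2 f}{\partial t^2}=\frac{\partial^2 f}{\partial x^2}+u\delta$ (with $f_0=f$, $f_1=\frac{\partial f}{\partial t}$ even in $x$) is described by $g=\frac{\partial f_0}{\partial x}+f_1$, which satisfies $\left(\frac{\partial}{\partial t}-\frac{\partial}{\partial x}\right)g(x,t)=\delta(x)u(t)$ on $\mathcal T\times[0,\infty)$ in the sense of distributions, with $g$ bounded measurable and $t\mapsto g(\cdot,t)$ continuous into distributions; equivalently $g(z,t)=g(z+t,0)+\sum_{k\in\mathbb Z,\ z+2k\pi\in[-t,0]}u(z+t+2k\pi)$. Admissible controls are measurable $u$ with $|u(t)|\le1$. The functional $\rho$ is $\rho(g)=2\pi\sup_{x\in\mathcal T}|g(x)|$ (essential supremum). The dry-friction control is the admissible control with $-u(t)\in\mathrm{sign}\,g(0,t)$ for a.e. $t$, where $\mathrm{sign}$ is multivalued with $\mathrm{sign}(0)=[-1,1]$ and $g(0,t)=\lim_{\epsilon\to0}\frac1{2\epsilon}\int_{-\epsilon}^\epsilon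 g(x,t)\,dx$; for each bounded initial $g(\cdot,0)$ it determines a unique motion. The $O$-terms are uniform: there are absolute constants $K,M_0,T_0$ such that $O(\cdot)$ is bounded in absolute value by $K\left(\frac1T+\frac1M\right)$ for all bounded measurable initial data $g(\cdot,0)$ and all $T$ with $T\ge T_0$, $M\ge M_0$, where $M=\min\{\rho(0),\rho(T)\}$ is computed along the motion under consideration. *)

theory Defs
  imports "HOL-Probability.Essential_Supremum"
begin

text \<open>
  Functions on the circle \<open>\<real> / 2\<pi>\<int>\<close> are represented by their \<open>2\<pi>\<close>-periodic lifts to \<open>\<real>\<close>.
\<close>

definition circle_state :: "(real \<Rightarrow> real) \<Rightarrow> bool" where
  "circle_state g \<longleftrightarrow>
     (\<forall>x. g (x + 2 * pi) = g x) \<and> g \<in> borel_measurable lebesgue \<and> (\<exists>B. \<forall>x. \<bar>g x\<bar> \<le> B)"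

definition admissible :: "(real \<Rightarrow> real) \<Rightarrow> bool" where
  "admissible u \<longleftrightarrow> u \<in> borel_measurable (lebesgue_on {0..}) \<and> (\<forall>t\<ge>0. \<bar>u t\<bar> \<le> 1)"

text \<open>
  \<open>motion g\<^sub>0 u t\<close> is the state \<open>g(\<cdot>, t)\<close> of the solution of
  \<open>(\<partial>/\<partial>t - \<partial>/\<partial>x) g = \<delta>(x) u(t)\<close> with initial state \<open>g\<^sub>0\<close>. The value \<open>z + t = x + s\<close> is constant along
  a characteristic, and the sum collects the jumps \<open>u(s)\<close> at the times \<open>s = z + t + 2k\<pi>\<close> in \<open>[0, t]\<close>
  at which the characteristic through \<open>(z, t)\<close> crosses the point \<open>0\<close> of the circle. The index set is
  finite, and closed versus half-open time intervals matter only on a null set of \<open>z\<close>.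
\<close>

definition motion :: "(real \<Rightarrow> real) \<Rightarrow> (real \<Rightarrow> real) \<Rightarrow> real \<Rightarrow> real \<Rightarrow> real" where
  "motion g\<^sub>0 u t z =
     g\<^sub>0 (z + t) +
     (\<Sum>k \<in> {k::int. z + 2 * of_int k * pi \<in> {-t..0}}. u (z + t + 2 * of_int k * pi))"

text \<open>
  The lift of a function on the circle has the same essential supremum over \<open>\<real>\<close> as the function
  has over the circle; it is finite for bounded measurable functions.
\<close>

definition rho :: "(real \<Rightarrow> real) \<Rightarrow> real" where
  "rho g = 2 * pi * real_of_ereal (esssup lebesgue (\<lambda>x. ereal \<bar>g x\<bar>))"

definition Sign :: "real \<Rightarrow> real set" where
  "Sign y = (if y = 0 then {-1..1} else {sgn y})"

definition has_value_at_zero :: "(real \<Rightarrow> real) \<Rightarrow> real \<Rightarrow> bool" where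
  "has_value_at_zero g y \<longleftrightarrow>
     ((\<lambda>\<epsilon>. 1 / (2 * \<epsilon>) * (LINT x:{-\<epsilon>..\<epsilon>}|lebesgue. g x)) \<longlongrightarrow> y) (at_right 0)"

definition dry_friction :: "(real \<Rightarrow> real) \<Rightarrow> (real \<Rightarrow> real) \<Rightarrow> bool" where
  "dry_friction g\<^sub>0 u \<longleftrightarrow>
     admissible u \<and>
     (AE t in lebesgue_on {0..}. \<exists>y. has_value_at_zero (motion g\<^sub>0 u t) y \<and> - u t \<in> Sign y)"

end

theory Submission
  imports Defs
begin

text \<open>
  In the moving coordinate \<open>y = z + t\<close> the transport term disappears: above a point \<open>y\<close> of the circle
  the state changes only at the times \<open>y\<close>, \<open>y + 2\<pi>\<close>, \<open>y + 4\<pi>\<close>, ... at which the characteristic passes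
  the point \<open>0\<close>, and there the current control value is added to it. So each \<open>y\<close> in \<open>(0, 2\<pi>)\<close> carries
  its own discrete dynamics \<open>p \<mapsto> p + u(y + 2\<pi>n)\<close>, and in time \<open>T\<close> the number of steps differs
  from \<open>T / 2\<pi>\<close> by at most \<open>1\<close>.

  Each step changes \<open>\<bar>p\<bar>\<close> by at most \<open>1\<close>, so no admissible control lowers \<open>\<rho>\<close>, which is \<open>2\<pi>\<close> times the
  essential supremum, by more than \<open>T + 2\<pi>\<close> (\<open>rho_decrease_le\<close>).

  At the time of a passage the state jumps at \<open>0\<close>, from \<open>p + v\<close> on the left to \<open>p\<close> on the right, where
  \<open>v\<close> is the control. By Lebesgue's differentiation theorem the value at zero of the state is therefore,
  for almost every time, the mean \<open>p + v/2\<close> (\<open>value_at_zero_eq_mean\<close>). Dry friction thus means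
  \<open>- v \<in> Sign (p + v/2)\<close>, that is, \<open>v\<close> is \<open>- 2p\<close> clipped to \<open>[-1, 1]\<close>. Consequently \<open>\<bar>p\<bar>\<close> decreases by
  exactly \<open>1\<close> in a step that starts with \<open>\<bar>p\<bar> \<ge> 1\<close>, and it is at most \<open>1/2\<close> after any other step
  (\<open>Sign_step\<close>, \<open>dry_friction_contracts\<close>). As long as
  the final \<open>\<rho>\<close> exceeds \<open>\<pi>\<close>, this gives a decrease of at least \<open>T - 2\<pi>\<close> (\<open>dry_friction_rho_le\<close>). Both
  errors are bounded by the constant \<open>2\<pi>\<close>, so dividing by \<open>T\<close> proves the claim.
\<close>

section \<open>The state along characteristics\<close>

text \<open>
  The state above the point \<open>y\<close> of the moving circle after \<open>n\<close> passages through \<open>0\<close>.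
\<close>

definition fibre_value :: "(real \<Rightarrow> real) \<Rightarrow> (real \<Rightarrow> real) \<Rightarrow> nat \<Rightarrow> real \<Rightarrow> real" where
  "fibre_value g u n y = g y + (\<Sum>j<n. u (y + 2 * pi * real j))"

lemma periodic_int:
  fixes g :: "real \<Rightarrow> 'a"
  assumes "\<And>x. g (x + 2 * pi) = g x"
  shows "g (x + 2 * pi * of_int k) = g x"
proof (induction k rule: int_induct[where k = 0])
  case (step1 i)
  then show ?case using assms[of "x + 2 * pi * of_int i"] by (simp add: algebra_simps)
next
  case (step2 i)
  then show ?case using assms[of "x + 2 * pi * of_int (i - 1)"] by (simp add: algebra_simps)
qed simp

text \<open>
  Since \<open>0 \<le> y < 2\<pi>\<close>, the passages of the characteristic \<open>z + t = y\<close> through \<open>0\<close> after time \<open>0\<close> occur at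
  \<open>y + 2\<pi>j\<close> with \<open>j \<ge> 0\<close>, and \<open>m\<close> counts those up to time \<open>t\<close>. The shift \<open>i\<close> allows every lift \<open>z\<close> of
  the position \<open>y - t\<close>.
\<close>

lemma motion_eq_fibre_value:
  assumes per: "\<And>x. g (x + 2 * pi) = g x" and y: "0 \<le> y" "y < 2 * pi"
    and m: "\<And>j. j < m \<longleftrightarrow> y + 2 * pi * real j \<le> t"
    and z: "z = y - t + 2 * pi * of_int i"
  shows "motion g u t z = fibre_value g u m y"
proof -
  have nonneg: "0 \<le> y + 2 * pi * of_int l \<longleftrightarrow> 0 \<le> l" for l :: int
  proof
    assume "0 \<le> y + 2 * pi * of_int l"
    then have "0 < 2 * pi * (1 + of_int l :: real)" using y by (simp add: algebra_simps)
    then have "0 < 1 + (of_int l :: real)" by (simp add: zero_less_mult_iff)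
    then show "0 \<le> l" by linarith
  qed (use y in auto)
  have "{k::int. z + 2 * of_int k * pi \<in> {-t..0}} = (\<lambda>j. int j - i) ` {..<m}"
  proof (intro set_eqI iffI)
    fix k :: int assume "k \<in> {k. z + 2 * of_int k * pi \<in> {-t..0}}"
    then have k: "0 \<le> y + 2 * pi * of_int (i + k)" "y + 2 * pi * of_int (i + k) \<le> t"
      unfolding z by (auto simp: algebra_simps)
    then have "0 \<le> i + k" using nonneg by blast
    with k m[of "nat (i + k)"] show "k \<in> (\<lambda>j. int j - i) ` {..<m}"
      by (intro image_eqI[of _ _ "nat (i + k)"]) auto
  next
    fix k assume "k \<in> (\<lambda>j. int j - i) ` {..<m}"
    then obtain j where "j < m" "k = int j - i" by auto
    moreover have "z + 2 * of_int k * pi = y + 2 * pi * real j - t"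
      unfolding z \<open>k = int j - i\<close> by (simp add: algebra_simps)
    ultimately show "k \<in> {k. z + 2 * of_int k * pi \<in> {-t..0}}"
      using m[of j] nonneg[of "int j"] by auto
  qed
  moreover have "inj_on (\<lambda>j. int j - i) {..<m}" by (auto simp: inj_on_def)
  moreover have "g (z + t) = g y"
    using periodic_int[of g y i] per by (simp add: z)
  ultimately show ?thesis
    unfolding motion_def fibre_value_def by (simp add: sum.reindex z algebra_simps)
qed

text \<open>
  At time \<open>x + 2\<pi>n\<close> the points just to the left of \<open>0\<close> have made their passage number \<open>n + 1\<close>, while
  those just to the right are about to make it. This is the jump that dry friction sees.
\<close>

lemma motion_near_zero:
  assumes per: "\<And>x. g (x + 2 * pi) = g x" and "0 < x + z" "x + z < 2 * pi" "\<bar>z\<bar> < 2 * pi"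
  shows "motion g u (x + 2 * pi * real n) z =
    (if z \<le> 0 then fibre_value g u (Suc n) (x + z) else fibre_value g u n (x + z))"
proof -
  have count: "x + z + 2 * pi * real j \<le> x + 2 * pi * real n \<longleftrightarrow> (if z \<le> 0 then j \<le> n else j < n)" for j
  proof -
    consider "j < n" | "j = n" | "n < j" by linarith
    then show ?thesis
    proof cases
      case 1
      then have "2 * pi * (real j + 1) \<le> 2 * pi * real n" by (intro mult_left_mono) auto
      then have "2 * pi * real j + 2 * pi \<le> 2 * pi * real n" by (simp add: algebra_simps)
      then show ?thesis using assms 1 by auto
    next
      case 3
      then have "2 * pi * (real n + 1) \<le> 2 * pi * real j" by (intro mult_left_mono) auto
      then have "2 * pi * real n + 2 * pi \<le> 2 * pi * real j" by (simp add: algebra_simps)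
      then show ?thesis using assms 3 by auto
    qed auto
  qed
  show ?thesis
    using motion_eq_fibre_value[where g = g and y = "x + z" and m = "if z \<le> 0 then Suc n else n"
        and t = "x + 2 * pi * real n" and z = z and i = "int n"] assms count
    by (auto simp: less_Suc_eq_le split: if_splits)
qed

section \<open>Almost-everywhere statements on the circle\<close>

lemma AE_lebesgue_translate:
  assumes "AE x in lebesgue. P (x::real)"
  shows "AE x in lebesgue. P (x + c)"
proof -
  obtain N where N: "negligible N" "{x. \<not> P x} \<subseteq> N"
    using assms by (auto simp: eventually_ae_filter_negligible)
  have "{x. \<not> P (x + c)} \<subseteq> (+) (-c) ` N"
    using N(2) by (force intro!: image_eqI[of _ _ "_ + c"])
  then show ?thesis
    using negligible_translation[OF N(1)] unfolding eventually_ae_filter_negligible by blast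
qed

lemma AE_lebesgue_reflect:
  assumes "AE x in lebesgue. P (x::real)"
  shows "AE x in lebesgue. P (- x)"
proof -
  obtain N where N: "negligible N" "{x. \<not> P x} \<subseteq> N"
    using assms by (auto simp: eventually_ae_filter_negligible)
  have "{x. \<not> P (- x)} \<subseteq> uminus ` N"
    using N(2) by (force intro!: image_eqI[of _ _ "- _"])
  moreover have "negligible (uminus ` N)"
    using N(1) by (intro negligible_differentiable_image_negligible)
      (auto intro!: derivative_intros)
  ultimately show ?thesis
    unfolding eventually_ae_filter_negligible by blast
qed

lemma AE_circle_lift:
  assumes per: "\<And>x. P (x + 2 * pi) = P x" and ae: "AE x in lebesgue. 0 < x \<and> x < 2 * pi \<longrightarrow> P x"
  shows "AE x in lebesgue. P x"
proof -
  have "AE x in lebesgue. \<forall>k::int. 0 < x + 2 * pi * of_int k \<and> x + 2 * pi * of_int k < 2 * pi \<longrightarrow> P (x + 2 * pi * of_int k)"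
    using AE_lebesgue_translate[OF ae] by (subst AE_all_countable) blast
  moreover have "AE x in lebesgue. x \<notin> range (\<lambda>k::int. 2 * pi * of_int k)"
    by (intro AE_not_in) (simp add: countable_imp_null_set_lborel null_sets_completionI)
  ultimately show ?thesis
  proof eventually_elim
    case (elim x)
    \<comment> \<open>The turn that moves \<open>x\<close> into the fundamental domain; the interval is open because
        \<open>x\<close> is not a multiple of \<open>2\<pi>\<close>.\<close>
    define k where "k = - \<lfloor>x / (2 * pi)\<rfloor>"
    have "x \<noteq> 2 * pi * of_int (-k)" using elim(2) by blast
    then have "0 < x + 2 * pi * of_int k" "x + 2 * pi * of_int k < 2 * pi"
      using floor_divide_lower[of "2 * pi" x] floor_divide_upper[of "2 * pi" x]
      unfolding k_def by (auto simp: algebra_simps)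
    with elim(1) periodic_int[of P x k] per show ?case by simp
  qed
qed

section \<open>One-sided and symmetric averages\<close>

lemma set_integrable_bounded:
  fixes f :: "real \<Rightarrow> real"
  assumes "f \<in> borel_measurable lebesgue" "\<And>x. \<bar>f x\<bar> \<le> B"
  shows "set_integrable lebesgue {a..b} f"
  unfolding set_integrable_def
  by (rule integrableI_bounded_set_indicator[where B = B]) (use assms in \<open>auto simp: emeasure_lborel_Icc_eq\<close>)

lemma shift_measurable_lebesgue:
  "f \<in> borel_measurable lebesgue \<Longrightarrow> (\<lambda>z. f (x + z)) \<in> borel_measurable lebesgue" for x :: real
  using measurable_compose[OF lebesgue_affine_measurable[where c = "\<lambda>_. 1" and t = x]] by simp

text \<open>
  Lebesgue differentiation is needed separately on each side of a point, because the state jumps at \<open>0\<close>.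
  The left-hand version follows from the right-hand one by reflection.
\<close>

lemma right_average_tendsto:
  fixes f :: "real \<Rightarrow> real"
  assumes f: "f \<in> borel_measurable lebesgue" "\<And>x. \<bar>f x\<bar> \<le> B"
  shows "AE x in lebesgue. ((\<lambda>h. integral {0..h} (\<lambda>z. f (x + z)) / h) \<longlongrightarrow> f x) (at_right 0)"
proof -
  have "f integrable_on cbox a b" for a b
    using set_lebesgue_integral_eq_integral(1)[OF set_integrable_bounded[OF f]] by simp
  then obtain N where "negligible N"
    and N: "\<And>x e. \<lbrakk>x \<notin> N; 0 < e\<rbrakk> \<Longrightarrow> \<exists>d>0. \<forall>h. 0 < h \<and> h < d \<longrightarrow>
              norm (integral (cbox x (x + h *\<^sub>R One)) f /\<^sub>R h ^ DIM(real) - f x) < e"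
    using integrable_ccontinuous_explicit[of f] by blast
  have "((\<lambda>h. integral {0..h} (\<lambda>z. f (x + z)) / h) \<longlongrightarrow> f x) (at_right 0)" if "x \<notin> N" for x
  proof (rule tendstoI)
    note x = that
    fix e :: real assume "0 < e"
    then obtain d where "d > 0" and d: "\<And>h. 0 < h \<Longrightarrow> h < d \<Longrightarrow> \<bar>integral {x..x + h} f / h - f x\<bar> < e"
      using N[OF x \<open>0 < e\<close>] by (auto simp: divide_inverse mult.commute)
    moreover have "integral {0..h} (\<lambda>z. f (x + z)) = integral {x..x + h} f" for h
      using integral_shift_Icc_real[of 0 h f x] by (simp add: o_def add.commute)
    ultimately show "\<forall>\<^sub>F h in at_right 0. dist (integral {0..h} (\<lambda>z. f (x + z)) / h) (f x) < e"
      by (auto simp: eventually_at_right_field dist_real_def)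
  qed
  then have "{x. \<not> ((\<lambda>h. integral {0..h} (\<lambda>z. f (x + z)) / h) \<longlongrightarrow> f x) (at_right 0)} \<subseteq> N"
    by blast
  with \<open>negligible N\<close> show ?thesis
    unfolding eventually_ae_filter_negligible by blast
qed

lemma left_average_tendsto:
  fixes f :: "real \<Rightarrow> real"
  assumes f: "f \<in> borel_measurable lebesgue" "\<And>x. \<bar>f x\<bar> \<le> B"
  shows "AE x in lebesgue. ((\<lambda>h. integral {-h..0} (\<lambda>z. f (x + z)) / h) \<longlongrightarrow> f x) (at_right 0)"
proof -
  have "(\<lambda>x. f (- x)) \<in> borel_measurable lebesgue"
    using measurable_compose[OF lebesgue_affine_measurable[where c = "\<lambda>_. -1" and t = "0::real"] f(1)]
    by simp
  from AE_lebesgue_reflect[OF right_average_tendsto[OF this f(2)]]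
  have "AE x in lebesgue. ((\<lambda>h. integral {0..h} (\<lambda>z. f (x - z)) / h) \<longlongrightarrow> f x) (at_right 0)"
    by simp
  moreover have "integral {0..h} (\<lambda>z. f (x - z)) = integral {-h..0} (\<lambda>z. f (x + z))" for x h
    using Henstock_Kurzweil_Integration.integral_reflect_real[of 0 "-h" "\<lambda>z. f (x + z)"] by simp
  ultimately show ?thesis by simp
qed

text \<open>
  A symmetric interval gives each of the two one-sided limits the weight \<open>1/2\<close>. The case distinction
  is the one in \<open>motion_near_zero\<close>, so that the lemma applies to the state at a passage time.
\<close>

lemma symmetric_average_tendsto:
  fixes f g :: "real \<Rightarrow> real"
  assumes f: "f \<in> borel_measurable lebesgue" "\<And>x. \<bar>f x\<bar> \<le> B"
    and g: "g \<in> borel_measurable lebesgue" "\<And>x. \<bar>g x\<bar> \<le> C"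
  shows "AE x in lebesgue. has_value_at_zero (\<lambda>z. if z \<le> 0 then f (x + z) else g (x + z)) ((f x + g x) / 2)"
  using left_average_tendsto[OF f] right_average_tendsto[OF g]
proof eventually_elim
  case (elim x)
  define s where "s = (\<lambda>z. if z \<le> 0 then f (x + z) else g (x + z))"
  have "s \<in> borel_measurable lebesgue"
    unfolding s_def using f g by (intro measurable_If shift_measurable_lebesgue) auto
  moreover have "\<bar>s z\<bar> \<le> max B C" for z
    using f(2)[of "x + z"] g(2)[of "x + z"] by (auto simp: s_def)
  ultimately have int: "set_integrable lebesgue {a..b} s" for a b
    by (rule set_integrable_bounded)
  have split: "(LINT z:{-h..h}|lebesgue. s z) =
      integral {-h..0} (\<lambda>z. f (x + z)) + integral {0..h} (\<lambda>z. g (x + z))" if "h > 0" for h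
  proof -
    have "(LINT z:{-h..h}|lebesgue. s z) = integral {-h..h} s"
      by (rule set_lebesgue_integral_eq_integral[OF int])
    also have "\<dots> = integral {-h..0} s + integral {0..h} s"
      using that set_lebesgue_integral_eq_integral(1)[OF int]
      by (intro Henstock_Kurzweil_Integration.integral_combine[symmetric]) auto
    also have "integral {-h..0} s = integral {-h..0} (\<lambda>z. f (x + z))"
      by (rule integral_cong) (auto simp: s_def)
    also have "integral {0..h} s = integral {0..h} (\<lambda>z. g (x + z))"
      by (rule integral_spike[of "{0}"]) (auto simp: s_def)
    finally show ?thesis .
  qed
  have "((\<lambda>h. (integral {-h..0} (\<lambda>z. f (x + z)) / h + integral {0..h} (\<lambda>z. g (x + z)) / h) / 2)
      \<longlongrightarrow> (f x + g x) / 2) (at_right 0)"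
    by (intro tendsto_intros elim) simp
  then have "((\<lambda>h. 1 / (2 * h) * (LINT z:{-h..h}|lebesgue. s z)) \<longlongrightarrow> (f x + g x) / 2) (at_right 0)"
    by (rule Lim_transform_eventually)
       (auto simp: eventually_at_right_field split field_simps intro!: exI[of _ 1])
  then show ?case
    unfolding has_value_at_zero_def s_def .
qed

section \<open>Dry friction along a fibre\<close>

lemma fibre_value_Suc:
  "fibre_value g u (Suc n) y = fibre_value g u n y + u (y + 2 * pi * real n)"
  by (simp add: fibre_value_def)

lemma fibre_value_measurable:
  assumes "g \<in> borel_measurable lebesgue" "u \<in> borel_measurable lebesgue"
  shows "fibre_value g u n \<in> borel_measurable lebesgue"
  unfolding fibre_value_def
  using assms shift_measurable_lebesgue[OF assms(2), of "2 * pi * real _"]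
  by (intro borel_measurable_add borel_measurable_sum) (simp_all add: add.commute)

lemma fibre_value_diff_le:
  assumes "\<And>t. \<bar>u t\<bar> \<le> 1"
  shows "\<bar>fibre_value g u n y - g y\<bar> \<le> real n"
proof -
  have "\<bar>\<Sum>j<n. u (y + 2 * pi * real j)\<bar> \<le> (\<Sum>j<n. 1)"
    by (rule order_trans[OF sum_abs sum_mono]) (rule assms)
  then show ?thesis by (simp add: fibre_value_def)
qed

lemma value_at_zero_eq_mean:
  assumes g: "circle_state g" and u: "u \<in> borel_measurable lebesgue" "\<And>t. \<bar>u t\<bar> \<le> 1"
  shows "AE x in lebesgue. 0 < x \<and> x < 2 * pi \<longrightarrow> has_value_at_zero (motion g u (x + 2 * pi * real n))
    ((fibre_value g u (Suc n) x + fibre_value g u n x) / 2)"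
proof -
  obtain B where B: "\<And>x. \<bar>g x\<bar> \<le> B" using g by (auto simp: circle_state_def)
  have bound: "\<bar>fibre_value g u m x\<bar> \<le> B + real m" for m x
    using fibre_value_diff_le[of u g m x, OF u(2)] B[of x] by linarith
  have meas: "fibre_value g u m \<in> borel_measurable lebesgue" for m
    using fibre_value_measurable g u(1) by (auto simp: circle_state_def)
  show ?thesis
    using symmetric_average_tendsto[OF meas bound meas bound, of "Suc n" n]
  proof eventually_elim
    case (elim x)
    show ?case
    proof
      assume x: "0 < x \<and> x < 2 * pi"
      have "(LINT z:{-\<epsilon>..\<epsilon>}|lebesgue. if z \<le> 0 then fibre_value g u (Suc n) (x + z) else fibre_value g u n (x + z))
          = (LINT z:{-\<epsilon>..\<epsilon>}|lebesgue. motion g u (x + 2 * pi * real n) z)"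
        if "0 < \<epsilon>" "\<epsilon> < min x (2 * pi - x)" for \<epsilon>
        using that g x by (intro set_lebesgue_integral_cong ballI allI impI)
          (auto simp: circle_state_def motion_near_zero)
      then have "\<forall>\<^sub>F \<epsilon> in at_right 0. 1 / (2 * \<epsilon>) * (LINT z:{-\<epsilon>..\<epsilon>}|lebesgue.
             if z \<le> 0 then fibre_value g u (Suc n) (x + z) else fibre_value g u n (x + z))
          = 1 / (2 * \<epsilon>) * (LINT z:{-\<epsilon>..\<epsilon>}|lebesgue. motion g u (x + 2 * pi * real n) z)"
        using x by (auto simp: eventually_at_right_field intro!: exI[of _ "min x (2 * pi - x)"])
      with elim show "has_value_at_zero (motion g u (x + 2 * pi * real n))
          ((fibre_value g u (Suc n) x + fibre_value g u n x) / 2)"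
        unfolding has_value_at_zero_def by (rule Lim_transform_eventually)
    qed
  qed
qed

text \<open>
  The relation determines \<open>v\<close>: it is \<open>- sgn p\<close> if \<open>\<bar>p\<bar> > 1/2\<close>, and \<open>- 2p\<close> otherwise. In the second case
  the mean vanishes and the step reflects \<open>p\<close> to \<open>- p\<close>, so the value \<open>1/2\<close> is never exceeded again.
\<close>

lemma Sign_step:
  assumes "- v \<in> Sign ((p + v + p) / 2)"
  shows "\<bar>p + v\<bar> \<le> max (\<bar>p\<bar> - 1) (1 / 2)"
  using assms by (auto simp: Sign_def sgn_if abs_if max_def split: if_splits)

text \<open>
  The friction law holds at almost every time. As countably many translates of the exceptional null set
  form a null set, it holds for almost every \<open>x\<close> at all passage times \<open>x + 2\<pi>n\<close> at once. For such \<open>x\<close>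
  the bound is an induction over the passages with \<open>Sign_step\<close>.
\<close>

lemma dry_friction_contracts:
  assumes g: "circle_state g" and u: "u \<in> borel_measurable lebesgue" "\<And>t. \<bar>u t\<bar> \<le> 1"
    and dry: "dry_friction g u"
  shows "AE x in lebesgue. 0 < x \<and> x < 2 * pi \<longrightarrow>
    (\<forall>n. \<bar>fibre_value g u n x\<bar> \<le> max (\<bar>g x\<bar> - real n) (1 / 2))"
proof -
  have "AE t in lebesgue. 0 \<le> t \<longrightarrow> (\<exists>y. has_value_at_zero (motion g u t) y \<and> - u t \<in> Sign y)"
    using dry unfolding dry_friction_def by (auto simp: AE_restrict_space_iff)
  then have "AE x in lebesgue. \<forall>n::nat. 0 \<le> x + 2 * pi * real n \<longrightarrow>
      (\<exists>y. has_value_at_zero (motion g u (x + 2 * pi * real n)) y \<and> - u (x + 2 * pi * real n) \<in> Sign y)"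
    unfolding AE_all_countable by (intro allI) (rule AE_lebesgue_translate)
  moreover have "AE x in lebesgue. \<forall>n. 0 < x \<and> x < 2 * pi \<longrightarrow>
      has_value_at_zero (motion g u (x + 2 * pi * real n))
        ((fibre_value g u (Suc n) x + fibre_value g u n x) / 2)"
    unfolding AE_all_countable using value_at_zero_eq_mean[OF g u] by blast
  ultimately show ?thesis
  proof eventually_elim
    case (elim x)
    show ?case
    proof (intro impI allI)
      fix n assume x: "0 < x \<and> x < 2 * pi"
      have step: "\<bar>fibre_value g u (Suc n) x\<bar> \<le> max (\<bar>fibre_value g u n x\<bar> - 1) (1 / 2)" for n
      proof -
        have "0 \<le> x + 2 * pi * real n" using x by simp
        then obtain y where y: "has_value_at_zero (motion g u (x + 2 * pi * real n)) y"
          and sign: "- u (x + 2 * pi * real n) \<in> Sign y"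
          using elim(1) by blast
        have "y = (fibre_value g u (Suc n) x + fibre_value g u n x) / 2"
          using tendsto_unique[OF trivial_limit_at_right_real] y elim(2) x
          unfolding has_value_at_zero_def by blast
        with sign show ?thesis
          using Sign_step[of "u (x + 2 * pi * real n)" "fibre_value g u n x"]
          by (simp add: fibre_value_Suc)
      qed
      show "\<bar>fibre_value g u n x\<bar> \<le> max (\<bar>g x\<bar> - real n) (1 / 2)"
      proof (induction n)
        case (Suc n)
        with step[of n] show ?case by auto
      qed (simp add: fibre_value_def)
    qed
  qed
qed

section \<open>Bounds for the functional along a motion\<close>

lemma motion_periodic:
  assumes "\<And>x. g (x + 2 * pi) = g x"
  shows "motion g u t (z + 2 * pi) = motion g u t z"
proof -
  have "(\<Sum>k \<in> {k::int. z + 2 * pi + 2 * of_int k * pi \<in> {-t..0}}. u (z + 2 * pi + t + 2 * of_int k * pi))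
      = (\<Sum>k \<in> {k::int. z + 2 * of_int k * pi \<in> {-t..0}}. u (z + t + 2 * of_int k * pi))"
    by (rule sum.reindex_bij_witness[of _ "\<lambda>k. k - 1" "\<lambda>k. k + 1"]) (auto simp: algebra_simps)
  then show ?thesis
    using assms[of "z + t"] by (simp add: motion_def algebra_simps)
qed

text \<open>
  Hence an estimate along the fibres over \<open>(0, 2\<pi>)\<close> is an estimate of the state on the whole circle.
\<close>

lemma AE_motion_lift:
  assumes "circle_state g" and ae: "AE y in lebesgue. 0 < y \<and> y < 2 * pi \<longrightarrow> Q (motion g u t (y - t))"
  shows "AE z in lebesgue. Q (motion g u t z)"
proof -
  have "motion g u t (y + 2 * pi - t) = motion g u t (y - t)" for y
    using motion_periodic[of g u t "y - t"] assms(1) by (simp add: circle_state_def algebra_simps)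
  then have "AE y in lebesgue. Q (motion g u t (y - t))"
    using ae by (intro AE_circle_lift[where P = "\<lambda>y. Q (motion g u t (y - t))"]) (simp_all only:)
  from AE_lebesgue_translate[OF this, of t] show ?thesis by simp
qed

lemma motion_along_fibre:
  assumes g: "circle_state g" and y: "0 < y" "y < 2 * pi" and "0 \<le> t"
  obtains m where "motion g u t (y - t) = fibre_value g u m y"
    and "t / (2 * pi) - 1 \<le> real m" and "real m \<le> t / (2 * pi) + 1"
proof -
  define q where "q = (t - y) / (2 * pi)"
  define m where "m = nat (\<lfloor>q\<rfloor> + 1)"
  have q: "t / (2 * pi) - 1 < q" "q < t / (2 * pi)" "-1 < q"
    using y \<open>0 \<le> t\<close> by (auto simp: q_def field_simps)
  have "j < m \<longleftrightarrow> y + 2 * pi * real j \<le> t" for j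
  proof -
    have "j < m \<longleftrightarrow> real j \<le> q" unfolding m_def by linarith
    then show ?thesis by (simp add: q_def field_simps)
  qed
  then have "motion g u t (y - t) = fibre_value g u m y"
    using g y by (intro motion_eq_fibre_value[where i = 0]) (auto simp: circle_state_def)
  moreover have "q < real m" "real m \<le> q + 1"
    unfolding m_def using q(3) by linarith+
  then have "t / (2 * pi) - 1 \<le> real m" "real m \<le> t / (2 * pi) + 1"
    using q by linarith+
  ultimately show thesis using that by blast
qed

lemma motion_0_eq:
  assumes "circle_state g" "0 < y" "y < 2 * pi"
  shows "motion g u 0 y = g y"
proof -
  have "\<not> y + 2 * pi * real j \<le> 0" for j
    using assms by (simp add: not_le add_pos_nonneg)
  then have "motion g u 0 y = fibre_value g u 0 y"
    using assms by (intro motion_eq_fibre_value[where i = 0]) (auto simp: circle_state_def)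
  then show ?thesis by (simp add: fibre_value_def)
qed

text \<open>
  The value \<open>rho g\<close> is \<open>0\<close> whenever the essential supremum of \<open>\<bar>g\<bar>\<close> is infinite, in particular when \<open>\<bar>g\<bar>\<close> is
  not measurable. With this default the upper bound for \<open>rho\<close> holds for every function, and a positive
  value of \<open>rho\<close> by itself guarantees a finite essential supremum.
\<close>

lemma rho_le:
  assumes "AE x in lebesgue. \<bar>g x\<bar> \<le> c" "0 \<le> c"
  shows "rho g \<le> 2 * pi * c"
proof -
  define e where "e = esssup lebesgue (\<lambda>x. ereal \<bar>g x\<bar>)"
  have "e = \<infinity> \<or> e \<le> ereal c"
  proof (cases "(\<lambda>x. ereal \<bar>g x\<bar>) \<in> borel_measurable lebesgue")
    case True
    with assms(1) show ?thesis unfolding e_def by (intro disjI2 esssup_I) simp_all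
  next
    case False
    then show ?thesis unfolding e_def by (simp add: esssup_non_measurable top_ereal_def)
  qed
  with \<open>0 \<le> c\<close> have "real_of_ereal e \<le> c" by (cases e) auto
  then show ?thesis by (simp add: rho_def e_def)
qed

lemma AE_le_rho:
  assumes "0 < rho g"
  shows "AE x in lebesgue. \<bar>g x\<bar> \<le> rho g / (2 * pi)"
proof -
  define e where "e = esssup lebesgue (\<lambda>x. ereal \<bar>g x\<bar>)"
  have "rho g / (2 * pi) = real_of_ereal e" by (simp add: rho_def e_def)
  moreover from this assms have "0 < real_of_ereal e" by (metis divide_pos_pos pi_gt_zero mult_pos_pos zero_less_numeral)
  then have "e = ereal (real_of_ereal e)" by (cases e) auto
  ultimately have "e = ereal (rho g / (2 * pi))" by simp
  with esssup_AE[of "\<lambda>x. ereal \<bar>g x\<bar>" lebesgue] show ?thesis by (simp flip: e_def)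
qed

lemma rho_decrease_le:
  assumes g: "circle_state g" and u: "\<And>t. \<bar>u t\<bar> \<le> 1" and "0 \<le> T" and pos: "0 < rho (motion g u T)"
  shows "rho (motion g u 0) \<le> rho (motion g u T) + T + 2 * pi"
proof -
  define c where "c = rho (motion g u T) / (2 * pi)"
  have "AE y in lebesgue. \<bar>motion g u T (y - T)\<bar> \<le> c"
    using AE_lebesgue_translate[OF AE_le_rho[OF pos], of "- T"] by (simp add: c_def)
  then have "AE y in lebesgue. 0 < y \<and> y < 2 * pi \<longrightarrow> \<bar>motion g u 0 (y - 0)\<bar> \<le> c + (T / (2 * pi) + 1)"
  proof eventually_elim
    case (elim y)
    show ?case
    proof
      assume y: "0 < y \<and> y < 2 * pi"
      obtain m where "motion g u T (y - T) = fibre_value g u m y" "real m \<le> T / (2 * pi) + 1"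
        using motion_along_fibre[OF g _ _ \<open>0 \<le> T\<close>, of y u] y by blast
      with elim fibre_value_diff_le[of u g m y, OF u] y g
      show "\<bar>motion g u 0 (y - 0)\<bar> \<le> c + (T / (2 * pi) + 1)"
        by (simp add: motion_0_eq)
    qed
  qed
  from rho_le[OF AE_motion_lift[OF g this]] have "rho (motion g u 0) \<le> 2 * pi * (c + (T / (2 * pi) + 1))"
    using pos \<open>0 \<le> T\<close> by (simp add: c_def)
  also have "\<dots> = rho (motion g u T) + T + 2 * pi"
    by (simp add: c_def field_simps)
  finally show ?thesis .
qed

lemma dry_friction_rho_le:
  assumes g: "circle_state g" and u: "u \<in> borel_measurable lebesgue" "\<And>t. \<bar>u t\<bar> \<le> 1"
    and dry: "dry_friction g u" and "0 \<le> T" and pos: "0 < rho (motion g u 0)"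
  shows "rho (motion g u T) \<le> max (rho (motion g u 0) - T + 2 * pi) pi"
proof -
  define c where "c = rho (motion g u 0) / (2 * pi)"
  define d where "d = max (c - (T / (2 * pi) - 1)) (1 / 2)"
  have "AE y in lebesgue. \<bar>motion g u 0 y\<bar> \<le> c"
    using AE_le_rho[OF pos] by (simp add: c_def)
  with dry_friction_contracts[OF g u dry]
  have "AE y in lebesgue. 0 < y \<and> y < 2 * pi \<longrightarrow> \<bar>motion g u T (y - T)\<bar> \<le> d"
  proof eventually_elim
    case (elim y)
    show ?case
    proof
      assume y: "0 < y \<and> y < 2 * pi"
      obtain m where "motion g u T (y - T) = fibre_value g u m y" "T / (2 * pi) - 1 \<le> real m"
        using motion_along_fibre[OF g _ _ \<open>0 \<le> T\<close>, of y u] y by blast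
      moreover have "\<bar>fibre_value g u m y\<bar> \<le> max (\<bar>g y\<bar> - real m) (1 / 2)" "\<bar>g y\<bar> \<le> c"
        using elim y g by (auto simp: motion_0_eq)
      ultimately show "\<bar>motion g u T (y - T)\<bar> \<le> d"
        unfolding d_def by linarith
    qed
  qed
  from rho_le[OF AE_motion_lift[OF g this]] have "rho (motion g u T) \<le> 2 * pi * d"
    by (simp add: d_def)
  also have "\<dots> = max (2 * pi * (c - (T / (2 * pi) - 1))) pi"
    unfolding d_def by (simp add: max_mult_distrib_left)
  also have "2 * pi * (c - (T / (2 * pi) - 1)) = rho (motion g u 0) - T + 2 * pi"
    by (simp add: c_def field_simps)
  finally show ?thesis .
qed

text \<open>
  Extending a control by \<open>0\<close> to negative times makes the fibre values of a circle state measurable and bounded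
  on the whole line, as Lebesgue differentiation requires, and it does not affect the motion.
\<close>

lemma admissible_extension:
  assumes "admissible u"
  obtains v where "v \<in> borel_measurable lebesgue" "\<And>t. \<bar>v t\<bar> \<le> 1"
    "motion g v = motion g u" "dry_friction g u \<Longrightarrow> dry_friction g v"
proof -
  define v where "v = (\<lambda>t. if t \<in> {0..} then u t else 0)"
  have v: "v \<in> borel_measurable lebesgue" "\<And>t. \<bar>v t\<bar> \<le> 1"
    using assms borel_measurable_if_I[of u "{0..}"] unfolding admissible_def v_def by simp_all
  have eq: "motion g v = motion g u"
    unfolding motion_def v_def by (intro ext arg_cong2[of _ _ _ _ "(+)"] sum.cong) auto
  have "dry_friction g v" if "dry_friction g u"
  proof -
    have "admissible v"
      using v measurable_restrict_space1[OF v(1)] by (simp add: admissible_def)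
    moreover have "v t = u t" if "t \<ge> 0" for t using that by (simp add: v_def)
    moreover have "AE t in lebesgue. 0 \<le> t \<longrightarrow> (\<exists>y. has_value_at_zero (motion g u t) y \<and> - u t \<in> Sign y)"
      using that by (simp add: dry_friction_def AE_restrict_space_iff)
    ultimately show ?thesis
      by (simp add: dry_friction_def AE_restrict_space_iff eq cong: imp_cong)
  qed
  with v eq that show thesis by blast
qed

theorem theorem6:
  shows "\<exists>K M\<^sub>0 T\<^sub>0 :: real. K > 0 \<and> M\<^sub>0 > 0 \<and> T\<^sub>0 > 0 \<and>
    (\<forall>g\<^sub>0 u :: real \<Rightarrow> real. \<forall>T M :: real.
       circle_state g\<^sub>0 \<longrightarrow> admissible u \<longrightarrow>
       M = min (rho (motion g\<^sub>0 u 0)) (rho (motion g\<^sub>0 u T)) \<longrightarrow>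
       T \<ge> T\<^sub>0 \<longrightarrow> M \<ge> M\<^sub>0 \<longrightarrow>
       (dry_friction g\<^sub>0 u \<longrightarrow>
          \<bar>(rho (motion g\<^sub>0 u 0) - rho (motion g\<^sub>0 u T)) / T - 1\<bar> \<le> K * (1 / T + 1 / M)) \<and>
       (rho (motion g\<^sub>0 u 0) - rho (motion g\<^sub>0 u T)) / T \<le> 1 + K * (1 / T + 1 / M))"
  \<comment> \<open>With \<open>M\<^sub>0 = 4 > \<pi>\<close> the final state is not confined to \<open>\<bar>g\<bar> \<le> 1/2\<close>, the region in
      which the decay stops.\<close>
proof (rule exI[of _ "2 * pi"], rule exI[of _ 4], rule exI[of _ 1], intro conjI allI impI)
  fix g u :: "real \<Rightarrow> real" and T M :: real
  assume g: "circle_state g" and u: "admissible u"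
    and M: "M = min (rho (motion g u 0)) (rho (motion g u T))" "M \<ge> 4" and T: "T \<ge> 1"
  define D where "D = rho (motion g u 0) - rho (motion g u T)"
  obtain v where v: "v \<in> borel_measurable lebesgue" "\<And>t. \<bar>v t\<bar> \<le> 1"
    and eq: "motion g v = motion g u" and dry: "dry_friction g u \<Longrightarrow> dry_friction g v"
    using admissible_extension[OF u] by metis
  have "D \<le> T + 2 * pi"
    using rho_decrease_le[of g v T, OF g v(2)] M T unfolding D_def eq by simp
  then have upper: "D / T \<le> 1 + 2 * pi * (1 / T)"
    using T by (simp add: field_simps)
  have slack: "2 * pi * (1 / T) \<le> 2 * pi * (1 / T + 1 / M)"
    using M by (intro mult_left_mono) auto
  show "(rho (motion g u 0) - rho (motion g u T)) / T \<le> 1 + 2 * pi * (1 / T + 1 / M)"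
    using upper slack unfolding D_def by linarith
  assume "dry_friction g u"
  then have "rho (motion g u T) \<le> max (rho (motion g u 0) - T + 2 * pi) pi"
    using dry_friction_rho_le[of g v T, OF g v dry] M T unfolding eq by simp
  then have "T - 2 * pi \<le> D"
    using M pi_less_4 unfolding D_def by linarith
  then have "(T - 2 * pi) / T \<le> D / T"
    using T by (intro divide_right_mono) auto
  then have "1 - 2 * pi * (1 / T) \<le> D / T"
    using T by (simp add: diff_divide_distrib)
  with upper slack show "\<bar>(rho (motion g u 0) - rho (motion g u T)) / T - 1\<bar> \<le> 2 * pi * (1 / T + 1 / M)"
    unfolding D_def by linarith
qed auto

end
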